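(* Let $\epsilon>0$, $\delta\ge0$ and $\gamma\ge0$. Let $\mathcal{A}_1$ be an event-level $(\epsilon,\delta)$-differentially private, $\gamma$-output-determined algorithm for \textsc{CountDistinct} that works in the general model and has error at most $\alpha$ for streams of length $T+1$ with probability $1-\beta$. Then there exists an item-level $(2\epsilon,(1+e^{\epsilon})\delta+e^{\epsilon}\gamma)$-differentially private algorithm $\mathcal{A}_2$ for \textsc{CountDistinct} that works in the ``likes''-model and has error at most $\alpha$ for streams of length $T$ with probability $1-\beta$.
   Context: Fix $d\ge1$. An input stream is a sequence $x=(x^1,x^2,\dots)$ with $x^t\in\{-1,0,1\}^d$. For an item $i$, $f^t(x_i)=1$ if $\sum_{t'\le t}x_i^{t'}>0$ and $0$ otherwise; $\textsc{CountDistinct}(x)^t=\sum_{i=1}^d f^t(x_i)$, and $\textsc{CountDistinct}(x)$ denotes the whole sequence of these values. A (randomized, continual observation) algorithm for \textsc{CountDistinct} outputs at each time $t$, as a function of $x^1,\dots,x^t$, an estimate of $\textsc{CountDistinct}(x)^t$; its error is the maximum over time steps of the absolute deviation. General model: all such streams are valid inputs. ``Likes''-model: only streams with $\sum_{t'\le t}x_i^{t'}\in\{0,1\}$ for all $i$ and $t$ are valid. Two streams are event-level neighboring if they differ in at most one entry $x_{i^*}^{t^*}$; item-level neighboring if there is an item $i^*$ such that $x_i^t=y_i^t$ for all $t$ and all $i\ne i^*$. An algorithm $A$ with output sequence $A(x)$ is $(\epsilon,\delta)$-differentially private (w.r.t. a neighboring notion) if for all neighboring valid inputs $x,y$ and all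 sets $S$ of output sequences, $\Pr[A(x)\in S]\le e^\epsilon\Pr[A(y)\in S]+\delta$. An algorithm $\mathcal{A}$ for \textsc{CountDistinct} is $\gamma$-output-determined if for all inputs $x,y$ with $\textsc{CountDistinct}(x)=\textsc{CountDistinct}(y)$ and every set $S$ of outputs, $\Pr(\mathcal{A}(x)\in S)\le\Pr(\mathcal{A}(y)\in S)+\gamma$. *)

theory Defs
  imports "HOL-Probability.Probability"
begin

text \<open>
  The items are the elements of a finite type \<open>'d\<close>, so \<open>d = CARD('d) \<ge> 1\<close>. A stream of length \<open>T\<close>
  is a list of \<open>T\<close> vectors; the entry \<open>x\<^sub>i\<^sup>t\<close> (\<open>t = 1, \<dots>, T\<close>) is \<open>x ! (t - 1) $ i\<close>.
\<close>

type_synonym 'd stream = "(int ^ 'd) list"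

definition balance :: "'d::finite stream \<Rightarrow> 'd \<Rightarrow> nat \<Rightarrow> int" where
  "balance x i t = (\<Sum>s<t. x ! s $ i)"

definition present :: "'d::finite stream \<Rightarrow> 'd \<Rightarrow> nat \<Rightarrow> nat" where
  "present x i t = (if balance x i t > 0 then 1 else 0)"

definition count_distinct_at :: "'d::finite stream \<Rightarrow> nat \<Rightarrow> nat" where
  "count_distinct_at x t = (\<Sum>i\<in>UNIV. present x i t)"

definition count_distinct :: "'d::finite stream \<Rightarrow> nat list" where
  "count_distinct x = map (count_distinct_at x) [1..<Suc (length x)]"

definition general_model :: "'d::finite stream set" where
  "general_model = {x. \<forall>v\<in>set x. \<forall>i. v $ i \<in> {-1, 0, 1}}"

definition likes_model :: "'d::finite stream set" where
  "likes_model = {x \<in> general_model. \<forall>i. \<forall>t\<le>length x. balance x i t \<in> {0, 1}}"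

definition event_neighboring :: "'d::finite stream \<Rightarrow> 'd stream \<Rightarrow> bool" where
  "event_neighboring x y \<longleftrightarrow> length x = length y \<and>
     (\<exists>i' t'. \<forall>t<length x. \<forall>i. (i, t) \<noteq> (i', t') \<longrightarrow> x ! t $ i = y ! t $ i)"

definition item_neighboring :: "'d::finite stream \<Rightarrow> 'd stream \<Rightarrow> bool" where
  "item_neighboring x y \<longleftrightarrow> length x = length y \<and>
     (\<exists>i'. \<forall>t<length x. \<forall>i. i \<noteq> i' \<longrightarrow> x ! t $ i = y ! t $ i)"

text \<open>
  A continual observation algorithm draws its randomness \<open>\<omega>\<close> from \<open>coins\<close>; its output at time \<open>t\<close> is
  \<open>estimate \<omega> (take t x)\<close>, hence a function of \<open>\<omega>\<close> and of the first \<open>t\<close> entries of the stream only.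
\<close>

record ('w, 'd) algorithm =
  coins :: "'w measure"
  estimate :: "'w \<Rightarrow> (int ^ 'd) list \<Rightarrow> real"

definition is_algorithm :: "'d::finite stream set \<Rightarrow> ('w, 'd) algorithm \<Rightarrow> bool" where
  "is_algorithm V A \<longleftrightarrow> prob_space (coins A) \<and>
     (\<forall>x\<in>V - {[]}. (\<lambda>\<omega>. estimate A \<omega> x) \<in> borel_measurable (coins A))"

definition output_space :: "nat \<Rightarrow> (nat \<Rightarrow> real) measure" where
  "output_space n = (\<Pi>\<^sub>M t\<in>{1..n}. borel)"

definition outputs :: "('w, 'd::finite) algorithm \<Rightarrow> 'd stream \<Rightarrow> 'w \<Rightarrow> nat \<Rightarrow> real" where
  "outputs A x \<omega> = (\<lambda>t\<in>{1..length x}. estimate A \<omega> (take t x))"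

definition output_law :: "('w, 'd::finite) algorithm \<Rightarrow> 'd stream \<Rightarrow> (nat \<Rightarrow> real) measure" where
  "output_law A x = distr (coins A) (output_space (length x)) (outputs A x)"

definition differentially_private ::
  "'d::finite stream set \<Rightarrow> ('d stream \<Rightarrow> 'd stream \<Rightarrow> bool) \<Rightarrow> real \<Rightarrow> real \<Rightarrow> ('w, 'd) algorithm \<Rightarrow> bool"
  where
  "differentially_private V nbr \<epsilon> \<delta> A \<longleftrightarrow>
     (\<forall>x\<in>V. \<forall>y\<in>V. nbr x y \<longrightarrow> (\<forall>S\<in>sets (output_space (length x)).
        measure (output_law A x) S \<le> exp \<epsilon> * measure (output_law A y) S + \<delta>))"

definition output_determined ::
  "'d::finite stream set \<Rightarrow> real \<Rightarrow> ('w, 'd) algorithm \<Rightarrow> bool" where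
  "output_determined V \<gamma> A \<longleftrightarrow>
     (\<forall>x\<in>V. \<forall>y\<in>V. count_distinct x = count_distinct y \<longrightarrow>
       (\<forall>S\<in>sets (output_space (length x)).
          measure (output_law A x) S \<le> measure (output_law A y) S + \<gamma>))"

text \<open>The inserted \<open>0\<close> only matters for the empty stream, on which the error is \<open>0\<close>.\<close>

definition error :: "('w, 'd::finite) algorithm \<Rightarrow> 'd stream \<Rightarrow> 'w \<Rightarrow> real" where
  "error A x \<omega> = Max (insert 0
     ((\<lambda>t. \<bar>outputs A x \<omega> t - real (count_distinct_at x t)\<bar>) ` {1..length x}))"

definition accurate ::
  "'d::finite stream set \<Rightarrow> nat \<Rightarrow> real \<Rightarrow> real \<Rightarrow> ('w, 'd) algorithm \<Rightarrow> bool" where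
  "accurate V n \<alpha> p A \<longleftrightarrow> (\<forall>x\<in>V. length x = n \<longrightarrow>
     measure (coins A) {\<omega> \<in> space (coins A). error A x \<omega> \<le> \<alpha>} \<ge> p)"

end

theory Submission
  imports Defs
begin

text \<open>
  Run \<open>A\<^sub>1\<close> on the stream with a zero vector prepended and discard the first output. Changing the
  prepended vector to \<open>-e\<^sub>i\<close> is an event-level change, and afterwards the balance of item \<open>i\<close> is at
  most \<open>0\<close> throughout for every stream of the likes model, so the distinct count no longer depends
  on item \<open>i\<close>. Two item-level neighbors are thus joined by an event-level step, an
  output-determined step and another event-level step.
\<close>

text \<open>The output at time \<open>t\<close> becomes
  \<open>estimate A \<omega> (0 # take t x)\<close>, which is what \<open>A\<close> outputs on
  \<open>0 # x\<close> at time \<open>t + 1\<close>. It still depends on the first \<open>t\<close>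
  entries only.\<close>

definition delay :: "('w, 'd::finite) algorithm \<Rightarrow> ('w, 'd) algorithm" where
  "delay A = A\<lparr>estimate := \<lambda>\<omega> x. estimate A \<omega> (0 # x)\<rparr>"

lemma coins_delay [simp]: "coins (delay A) = coins A"
  by (simp add: delay_def)

lemma estimate_delay [simp]: "estimate (delay A) \<omega> x = estimate A \<omega> (0 # x)"
  by (simp add: delay_def)

text \<open>Dropping the first output as a map between output spaces, so that the delayed algorithm
  is a post-processing of \<open>A\<close>.\<close>

definition shift_output :: "nat \<Rightarrow> (nat \<Rightarrow> real) \<Rightarrow> nat \<Rightarrow> real" where
  "shift_output n f = (\<lambda>t\<in>{1..n}. f (Suc t))"

lemma shift_output_measurable [measurable]:
  "shift_output n \<in> output_space (Suc n) \<rightarrow>\<^sub>M output_space n"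
  unfolding output_space_def shift_output_def
  by (rule measurable_restrict) (auto intro!: measurable_component_singleton)

lemma outputs_delay: "outputs (delay A) x \<omega> = shift_output (length x) (outputs A (0 # x) \<omega>)"
  by (auto simp: outputs_def shift_output_def restrict_def)

lemma general_model_take: "x \<in> general_model \<Longrightarrow> take t x \<in> general_model"
  by (auto simp: general_model_def dest: in_set_takeD)

lemma general_model_Cons:
  "v # x \<in> general_model \<longleftrightarrow> (\<forall>i. v $ i \<in> {-1, 0, 1}) \<and> x \<in> general_model"
  by (auto simp: general_model_def)

lemma likes_model_subset_general_model: "likes_model \<subseteq> general_model"
  by (auto simp: likes_model_def)

lemma outputs_measurable:
  assumes "is_algorithm general_model A" "x \<in> general_model"
  shows "outputs A x \<in> coins A \<rightarrow>\<^sub>M output_space (length x)"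
  unfolding output_space_def outputs_def
proof (rule measurable_restrict)
  fix t assume "t \<in> {1..length x}"
  then have "take t x \<noteq> []" by auto
  with assms general_model_take show "(\<lambda>\<omega>. estimate A \<omega> (take t x)) \<in> borel_measurable (coins A)"
    unfolding is_algorithm_def by blast
qed

text \<open>Since the law is a pushforward, an event \<open>S\<close> for the delayed algorithm has
  the probability of the preimage of \<open>S\<close> under \<open>A\<close>. Bounds for
  \<open>A\<close> therefore transfer without loss.\<close>

lemma output_law_delay:
  assumes "is_algorithm general_model A" "0 # x \<in> general_model"
  shows "output_law (delay A) x =
    distr (output_law A (0 # x)) (output_space (length x)) (shift_output (length x))"
proof -
  have "outputs A (0 # x) \<in> coins A \<rightarrow>\<^sub>M output_space (Suc (length x))"
    using outputs_measurable[OF assms] by simp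
  then have "distr (output_law A (0 # x)) (output_space (length x)) (shift_output (length x)) =
      distr (coins A) (output_space (length x)) (shift_output (length x) \<circ> outputs A (0 # x))"
    unfolding output_law_def by (simp add: distr_distr)
  also have "\<dots> = output_law (delay A) x"
    unfolding output_law_def by (simp add: comp_def outputs_delay[abs_def])
  finally show ?thesis ..
qed

lemma is_algorithm_delay:
  assumes "is_algorithm general_model A"
  shows "is_algorithm general_model (delay A)"
  using assms by (auto simp: is_algorithm_def general_model_Cons)

lemma balance_Cons_Suc: "balance (v # x) i (Suc t) = v $ i + balance x i t"
  unfolding balance_def by (subst sum.lessThan_Suc_shift) simp

lemma count_distinct_at_Cons_zero: "count_distinct_at (0 # x) (Suc t) = count_distinct_at x t"
  by (simp add: count_distinct_at_def present_def balance_Cons_Suc)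

text \<open>The upper bound 1 on balances in the likes model enters here: after a prepended -1, item
  \<open>i\<close> has balance at most 0 in both streams and contributes 0. Every other item has
  equal balances, as its entries agree.\<close>

lemma count_distinct_at_blocked:
  assumes x: "x \<in> likes_model" and y: "y \<in> likes_model" and "length x = length y"
    and eq: "\<And>t j. t < length x \<Longrightarrow> j \<noteq> i \<Longrightarrow> x ! t $ j = y ! t $ j"
    and t: "t \<le> length x"
  shows "count_distinct_at (axis i (-1) # x) (Suc t) = count_distinct_at (axis i (-1) # y) (Suc t)"
  unfolding count_distinct_at_def
proof (rule sum.cong[OF refl])
  fix j
  show "present (axis i (-1) # x) j (Suc t) = present (axis i (-1) # y) j (Suc t)"
  proof (cases "j = i")
    case True
    have "balance x i t \<in> {0, 1}" "balance y i t \<in> {0, 1}"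
      using x y t \<open>length x = length y\<close> unfolding likes_model_def by simp_all
    then have "balance x i t \<le> 1" "balance y i t \<le> 1"
      by auto
    with True show ?thesis by (simp add: present_def balance_Cons_Suc)
  next
    case False
    then have "balance x j t = balance y j t"
      unfolding balance_def using eq t by (intro sum.cong) auto
    then show ?thesis by (simp add: present_def balance_Cons_Suc)
  qed
qed

lemma count_distinct_blocked:
  assumes "x \<in> likes_model" "y \<in> likes_model" "length x = length y"
    and "\<And>t j. t < length x \<Longrightarrow> j \<noteq> i \<Longrightarrow> x ! t $ j = y ! t $ j"
  shows "count_distinct (axis i (-1) # x) = count_distinct (axis i (-1) # y)"
  unfolding count_distinct_def
proof (rule map_cong)
  fix t assume "t \<in> set [1..<Suc (length (axis i (-1) # y))]"
  then have "1 \<le> t" "t \<le> Suc (length x)"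
    using assms(3) unfolding set_upt by auto
  \<comment> \<open>The case \<open>s = 0\<close> is the time at which only the prepended vector has
    been read.\<close>
  then obtain s where "t = Suc s" "s \<le> length x"
    by (cases t) auto
  then show "count_distinct_at (axis i (-1) # x) t = count_distinct_at (axis i (-1) # y) t"
    using count_distinct_at_blocked[OF assms] by simp
qed (simp add: assms(3))

lemma event_neighboring_Cons:
  assumes "\<And>j. j \<noteq> i \<Longrightarrow> v $ j = w $ j"
  shows "event_neighboring (v # x) (w # x)"
  unfolding event_neighboring_def
proof (intro conjI exI[of _ i] exI[of _ "0::nat"] allI impI)
  fix t j assume "(j, t) \<noteq> (i, 0::nat)"
  then show "(v # x) ! t $ j = (w # x) ! t $ j"
    using assms by (cases t) auto
qed simp

lemma differentially_private_delay:
  fixes A :: "('w, 'd::finite) algorithm"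
  assumes alg: "is_algorithm general_model A"
    and dp: "differentially_private general_model event_neighboring \<epsilon> \<delta> A"
    and od: "output_determined general_model \<gamma> A"
  shows "differentially_private likes_model item_neighboring
    (2 * \<epsilon>) ((1 + exp \<epsilon>) * \<delta> + exp \<epsilon> * \<gamma>) (delay A)"
  unfolding differentially_private_def
proof (intro ballI impI)
  fix x y :: "'d stream" and S
  assume x: "x \<in> likes_model" and y: "y \<in> likes_model" and "item_neighboring x y"
    and S: "S \<in> sets (output_space (length x))"
  then obtain i where len: "length x = length y"
    and "\<forall>t<length x. \<forall>j. j \<noteq> i \<longrightarrow> x ! t $ j = y ! t $ j"
    unfolding item_neighboring_def by blast
  then have eq: "x ! t $ j = y ! t $ j" if "t < length x" "j \<noteq> i" for t j
    using that by blast
  \<comment> \<open>Streams starting with \<open>block\<close> leave the likes model, since item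
    \<open>i\<close> has balance -1 after one step. They are valid inputs for \<open>A\<close>
    because it works in the general model.\<close>
  define block :: "int ^ 'd" where "block = axis i (-1)"
  \<comment> \<open>All four streams compared below have length \<open>Suc (length x)\<close>, so a
    single event, the preimage of \<open>S\<close>, serves for every step.\<close>
  define P where "P z = measure (output_law A z)
    (shift_output (length x) -` S \<inter> space (output_space (Suc (length x))))" for z
  have pre: "shift_output (length x) -` S \<inter> space (output_space (Suc (length x)))
      \<in> sets (output_space (Suc (length x)))"
    by (rule measurable_sets[OF shift_output_measurable S])
  have gen: "0 # z \<in> general_model" "block # z \<in> general_model" if "z \<in> likes_model" for z
    using that likes_model_subset_general_model
    by (auto simp: general_model_Cons block_def axis_def)
  have law: "measure (output_law (delay A) z) S = P (0 # z)"
    if "z \<in> likes_model" "length z = length x" for z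
  proof -
    have "space (output_law A (0 # z)) = space (output_space (Suc (length x)))"
      "shift_output (length x) \<in> output_law A (0 # z) \<rightarrow>\<^sub>M output_space (length x)"
      using that(2) by (simp_all add: output_law_def)
    then show ?thesis
      using S that by (simp add: output_law_delay[OF alg gen(1)] measure_distr P_def)
  qed
  have nbr: "event_neighboring (0 # z) (block # z)" "event_neighboring (block # z) (0 # z)" for z
    by (auto intro!: event_neighboring_Cons[where i = i] simp: block_def axis_def)
  have dp_step: "P u \<le> exp \<epsilon> * P v + \<delta>"
    if "u \<in> general_model" "v \<in> general_model" "event_neighboring u v" "length u = Suc (length x)"
    for u v
    using dp that pre unfolding differentially_private_def P_def by metis
  have od_step: "P (block # x) \<le> P (block # y) + \<gamma>"
    using od gen(2)[OF x] gen(2)[OF y] pre count_distinct_blocked[OF x y len eq]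
    unfolding output_determined_def P_def block_def by (metis length_Cons)
  \<comment> \<open>The chain runs from \<open>0 # x\<close> through \<open>block # x\<close> and
    \<open>block # y\<close> to \<open>0 # y\<close>.\<close>
  have "P (0 # x) \<le> exp \<epsilon> * P (block # x) + \<delta>"
    using dp_step[OF gen[OF x] nbr(1)] by simp
  also note od_step
  also have "P (block # y) \<le> exp \<epsilon> * P (0 # y) + \<delta>"
    using dp_step[OF gen(2,1)[OF y] nbr(2)] len by simp
  \<comment> \<open>The first step multiplies everything after it by \<open>exp \<epsilon>\<close>;
    hence \<gamma> and one of the two \<delta> carry that factor.\<close>
  finally have "P (0 # x) \<le> exp \<epsilon> * (exp \<epsilon> * P (0 # y) + \<delta> + \<gamma>) + \<delta>"
    by simp
  also have "\<dots> = exp (2 * \<epsilon>) * P (0 # y) + ((1 + exp \<epsilon>) * \<delta> + exp \<epsilon> * \<gamma>)"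
    unfolding mult_2 exp_add by (simp add: algebra_simps)
  finally show "measure (output_law (delay A) x) S \<le> exp (2 * \<epsilon>) *
      measure (output_law (delay A) y) S + ((1 + exp \<epsilon>) * \<delta> + exp \<epsilon> * \<gamma>)"
    using law x y len by simp
qed

text \<open>The conjunct on the sign of \<alpha> comes from the 0 inserted under
  \<open>Max\<close>.\<close>

lemma error_le_iff:
  "error A x \<omega> \<le> \<alpha> \<longleftrightarrow> 0 \<le> \<alpha> \<and>
    (\<forall>t\<in>{1..length x}. \<bar>estimate A \<omega> (take t x) - real (count_distinct_at x t)\<bar> \<le> \<alpha>)"
  by (auto simp: error_def outputs_def)

text \<open>The zero vector leaves all balances unchanged, so the deviations of
  \<open>delay A\<close> on \<open>x\<close> are those of \<open>A\<close> on \<open>0 # x\<close>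
  at times 2 and later: a maximum over fewer times.\<close>

lemma error_delay_le: "error (delay A) x \<omega> \<le> error A (0 # x) \<omega>"
proof -
  let ?\<alpha> = "error A (0 # x) \<omega>"
  \<comment> \<open>Reading \<open>error_le_iff\<close> at the error itself yields the bound at each
    time.\<close>
  have "?\<alpha> \<le> ?\<alpha>" by simp
  then have *: "0 \<le> ?\<alpha>" "\<And>t. t \<in> {1..length (0 # x)} \<Longrightarrow>
      \<bar>estimate A \<omega> (take t (0 # x)) - real (count_distinct_at (0 # x) t)\<bar> \<le> ?\<alpha>"
    unfolding error_le_iff by blast+
  show ?thesis
    unfolding error_le_iff
  proof (intro conjI ballI)
    fix t assume "t \<in> {1..length x}"
    then show "\<bar>estimate (delay A) \<omega> (take t x) - real (count_distinct_at x t)\<bar> \<le> ?\<alpha>"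
      using *(2)[of "Suc t"] by (simp add: count_distinct_at_Cons_zero)
  qed (rule *(1))
qed

lemma error_measurable:
  assumes "is_algorithm general_model A" "x \<in> general_model"
  shows "{\<omega> \<in> space (coins A). error A x \<omega> \<le> \<alpha>} \<in> sets (coins A)"
proof -
  have [measurable]: "(\<lambda>\<omega>. estimate A \<omega> (take t x)) \<in> borel_measurable (coins A)"
    if "t \<in> {1..length x}" for t
  proof -
    from that have "take t x \<noteq> []" by auto
    with assms general_model_take show ?thesis unfolding is_algorithm_def by blast
  qed
  show ?thesis unfolding error_le_iff by measurable
qed

lemma accurate_delay:
  fixes A :: "('w, 'd::finite) algorithm"
  assumes alg: "is_algorithm general_model A" and acc: "accurate general_model (T + 1) \<alpha> p A"
  shows "accurate general_model T \<alpha> p (delay A)"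
  unfolding accurate_def
proof (intro ballI impI)
  fix x :: "'d stream" assume x: "x \<in> general_model" "length x = T"
  then have "0 # x \<in> general_model" "length (0 # x) = T + 1"
    by (auto simp: general_model_Cons)
  then have "p \<le> measure (coins A) {\<omega> \<in> space (coins A). error A (0 # x) \<omega> \<le> \<alpha>}"
    using acc unfolding accurate_def by blast
  also have "\<dots> \<le> measure (coins A) {\<omega> \<in> space (coins A). error (delay A) x \<omega> \<le> \<alpha>}"
  proof -
    interpret prob_space "coins A" using alg by (simp add: is_algorithm_def)
    \<comment> \<open>Monotonicity of the measure requires the larger event to be
      measurable.\<close>
    have "{\<omega> \<in> space (coins A). error (delay A) x \<omega> \<le> \<alpha>} \<in> sets (coins A)"
      using error_measurable[OF is_algorithm_delay[OF alg] x(1)] by simp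
    then show ?thesis
      using error_delay_le[of A x] by (intro finite_measure_mono) (auto intro: order_trans)
  qed
  finally show "p \<le> measure (coins (delay A))
      {\<omega> \<in> space (coins (delay A)). error (delay A) x \<omega> \<le> \<alpha>}"
    by simp
qed

theorem theorem4p2:
  fixes \<epsilon> \<delta> \<gamma> \<alpha> \<beta> :: real and T :: nat
    and A\<^sub>1 :: "('w, 'd::finite) algorithm"
  assumes "\<epsilon> > 0" and "\<delta> \<ge> 0" and "\<gamma> \<ge> 0"
    and "is_algorithm general_model A\<^sub>1"
    and "differentially_private general_model event_neighboring \<epsilon> \<delta> A\<^sub>1"
    and "output_determined general_model \<gamma> A\<^sub>1"
    and "accurate general_model (T + 1) \<alpha> (1 - \<beta>) A\<^sub>1"
  shows "\<exists>A\<^sub>2 :: ('w, 'd) algorithm.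
           is_algorithm likes_model A\<^sub>2 \<and>
           differentially_private likes_model item_neighboring
             (2 * \<epsilon>) ((1 + exp \<epsilon>) * \<delta> + exp \<epsilon> * \<gamma>) A\<^sub>2 \<and>
           accurate likes_model T \<alpha> (1 - \<beta>) A\<^sub>2"
proof (intro exI conjI)
  show "is_algorithm likes_model (delay A\<^sub>1)"
    using is_algorithm_delay[OF assms(4)] likes_model_subset_general_model
    unfolding is_algorithm_def by blast
  show "differentially_private likes_model item_neighboring
      (2 * \<epsilon>) ((1 + exp \<epsilon>) * \<delta> + exp \<epsilon> * \<gamma>) (delay A\<^sub>1)"
    by (rule differentially_private_delay[OF assms(4-6)])
  show "accurate likes_model T \<alpha> (1 - \<beta>) (delay A\<^sub>1)"
    using accurate_delay[OF assms(4,7)] likes_model_subset_general_model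
    unfolding accurate_def by blast
qed

end
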